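(* Let $f:\mathbb{R}^n\to\mathbb{R}$ be twice differentiable and bounded below with $L$-Lipschitz gradient and $M$-Lipschitz Hessian ($L,M>0$), let $\epsilon>0$ and $C\ge0$. Suppose $x^*$ is a second-order stationary point of $f$ (so $\nabla f(x^* )=0$) such that $\nabla^2 f(x^* )\succeq\mu I$ for some $\mu>0$. Then DRSOM with fixed radius $\Delta_k=\Delta=\frac{2\sqrt\epsilon}{M}$ converges to $x^*$ quadratically once an iterate is sufficiently close to $x^*$: there exist $\delta>0$ and $K>0$ such that, for every sequence $(x_j)$ generated by DRSOM satisfying $\|(H_j-\tilde H_j)d_{j+1}\|\le C\|d_{j+1}\|^2$ for all $j$, if $\|x_k-x^*\|\le\delta$ for some $k$, then $x_j\to x^*$ and $$\|x_{j+1}-x^*\|\le K\|x_j-x^*\|^2\qquad\text{for all } j\ge k.$$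
   Context: Notation: $\|\cdot\|$ is the Euclidean norm (and induced matrix norm), $g_k=\nabla f(x_k)$, $H_k=\nabla^2 f(x_k)$. Lipschitz assumptions: $\|\nabla f(x)-\nabla f(y)\|\le L\|x-y\|$ and $\|\nabla^2 f(x)-\nabla^2 f(y)\|\le M\|x-y\|$ for all $x,y\in\mathbb{R}^n$. DRSOM iteration: for $k\ge1$ put $d_k=x_k-x_{k-1}$, and put $d_0=0$. Let $\mathcal{L}_k=\mathrm{span}\{g_k,d_k\}$ and let $V_k$ be a matrix whose columns form an orthonormal basis of $\mathcal{L}_k$. Let $\alpha_k$ be a global solution of the trust-region subproblem $$\min_{\alpha}\ f(x_k)+\alpha^TV_k^Tg_k+\tfrac12\alpha^TV_k^TH_kV_k\alpha\quad\text{s.t. }\|\alpha\|\le\Delta_k,$$ with associated Lagrange multiplier $\lambda_k\ge 0$, i.e. $(V_k^TH_kV_k+\lambda_kI)\alpha_k=-V_k^Tg_k$, $V_k^TH_kV_k+\lambda_kI\succeq0$, $\lambda_k(\Delta_k-\|\alpha_k\|)=0$. Set $d_{k+1}=V_k\alpha_k$ and $x_{k+1}=x_k+d_{k+1}$ (every step is accepted). The projected (approximate) Hessian is $\tilde H_k=V_kV_k^TH_kV_kV_k^T$. *)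

theory Defs
  imports "HOL-Analysis.Analysis"
begin

(* Euclidean space is real ^ 'n.  The matrices V_k have n rows and r = dim L_k columns, where
   r is 0, 1 or 2 and varies with k.  Such a matrix is the list of its columns, and vectors and
   matrices of size r are functions on nat of which only the indices below r are looked at. *)

definition dot_r :: "nat \<Rightarrow> (nat \<Rightarrow> real) \<Rightarrow> (nat \<Rightarrow> real) \<Rightarrow> real" where
  "dot_r r a b = (\<Sum>i<r. a i * b i)"

definition mult_r :: "nat \<Rightarrow> (nat \<Rightarrow> nat \<Rightarrow> real) \<Rightarrow> (nat \<Rightarrow> real) \<Rightarrow> nat \<Rightarrow> real" where
  "mult_r r A a = (\<lambda>i. \<Sum>j<r. A i j * a j)"

(* A + c I *)
definition shift_r :: "(nat \<Rightarrow> nat \<Rightarrow> real) \<Rightarrow> real \<Rightarrow> nat \<Rightarrow> nat \<Rightarrow> real" where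
  "shift_r A c = (\<lambda>i j. A i j + (if i = j then c else 0))"

(* The orders below are only used for Hessians and their compressions, which are symmetric
   because the second derivative is continuous; so symmetry is not demanded again. *)
definition psd_r :: "nat \<Rightarrow> (nat \<Rightarrow> nat \<Rightarrow> real) \<Rightarrow> bool" where
  "psd_r r A \<longleftrightarrow> (\<forall>a. 0 \<le> dot_r r a (mult_r r A a))"

definition psd :: "real ^ 'n ^ 'n \<Rightarrow> bool" where
  "psd A \<longleftrightarrow> (\<forall>v. 0 \<le> v \<bullet> (A *v v))"

definition orthonormal_basis :: "(real ^ 'n) list \<Rightarrow> (real ^ 'n) set \<Rightarrow> bool" where
  "orthonormal_basis V S \<longleftrightarrow>
     (\<forall>i<length V. \<forall>j<length V. V ! i \<bullet> V ! j = (if i = j then 1 else 0)) \<and> span (set V) = S"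

(* V a *)
definition cols_mult :: "(real ^ 'n) list \<Rightarrow> (nat \<Rightarrow> real) \<Rightarrow> real ^ 'n" where
  "cols_mult V a = (\<Sum>i<length V. a i *\<^sub>R V ! i)"

(* V^T v *)
definition cols_transpose_mult :: "(real ^ 'n) list \<Rightarrow> real ^ 'n \<Rightarrow> nat \<Rightarrow> real" where
  "cols_transpose_mult V v = (\<lambda>i. V ! i \<bullet> v)"

(* V^T H V *)
definition reduced_hessian :: "real ^ 'n ^ 'n \<Rightarrow> (real ^ 'n) list \<Rightarrow> nat \<Rightarrow> nat \<Rightarrow> real" where
  "reduced_hessian H V = (\<lambda>i j. V ! i \<bullet> (H *v V ! j))"

(* V V^T *)
definition cols_gram :: "(real ^ 'n) list \<Rightarrow> real ^ 'n ^ 'n" where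
  "cols_gram V = (\<chi> a b. \<Sum>i<length V. V ! i $ a * V ! i $ b)"

definition projected_hessian :: "real ^ 'n ^ 'n \<Rightarrow> (real ^ 'n) list \<Rightarrow> real ^ 'n ^ 'n" where
  "projected_hessian H V = cols_gram V ** H ** cols_gram V"

definition tr_model ::
    "real \<Rightarrow> real ^ 'n \<Rightarrow> real ^ 'n ^ 'n \<Rightarrow> (real ^ 'n) list \<Rightarrow> (nat \<Rightarrow> real) \<Rightarrow> real" where
  "tr_model c g H V a =
     c + dot_r (length V) a (cols_transpose_mult V g)
       + 1/2 * dot_r (length V) a (mult_r (length V) (reduced_hessian H V) a)"

definition tr_solution ::
    "real \<Rightarrow> real ^ 'n \<Rightarrow> real ^ 'n ^ 'n \<Rightarrow> (real ^ 'n) list \<Rightarrow> real \<Rightarrow> (nat \<Rightarrow> real) \<Rightarrow> bool" where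
  "tr_solution c g H V \<Delta> a \<longleftrightarrow>
     is_arg_min (tr_model c g H V) (\<lambda>b. L2_set b {..<length V} \<le> \<Delta>) a"

definition tr_multiplier ::
    "real ^ 'n \<Rightarrow> real ^ 'n ^ 'n \<Rightarrow> (real ^ 'n) list \<Rightarrow> real \<Rightarrow> (nat \<Rightarrow> real) \<Rightarrow> real \<Rightarrow> bool" where
  "tr_multiplier g H V \<Delta> a l \<longleftrightarrow>
     l \<ge> 0 \<and>
     (\<forall>i<length V. mult_r (length V) (shift_r (reduced_hessian H V) l) a i
                     = - cols_transpose_mult V g i) \<and>
     psd_r (length V) (shift_r (reduced_hessian H V) l) \<and>
     l * (\<Delta> - L2_set a {..<length V}) = 0"

definition momentum :: "(nat \<Rightarrow> 'a::real_vector) \<Rightarrow> nat \<Rightarrow> 'a" where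
  "momentum x k = (case k of 0 \<Rightarrow> 0 | Suc j \<Rightarrow> x (Suc j) - x j)"

(* g and H are the gradient and the Hessian of f; V, a and l are the bases, the subproblem
   solutions and the multipliers chosen along the run.  The last line of the body is
   d_(k+1) = V_k a_k, so that momentum x (Suc k) is the step d_(k+1). *)
definition drsom ::
    "(real ^ 'n \<Rightarrow> real) \<Rightarrow> (real ^ 'n \<Rightarrow> real ^ 'n) \<Rightarrow> (real ^ 'n \<Rightarrow> real ^ 'n ^ 'n) \<Rightarrow>
     (nat \<Rightarrow> real) \<Rightarrow> (nat \<Rightarrow> real ^ 'n) \<Rightarrow> (nat \<Rightarrow> (real ^ 'n) list) \<Rightarrow> (nat \<Rightarrow> nat \<Rightarrow> real) \<Rightarrow>
     (nat \<Rightarrow> real) \<Rightarrow> bool" where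
  "drsom f g H \<Delta> x V a l \<longleftrightarrow>
     (\<forall>k. orthonormal_basis (V k) (span {g (x k), momentum x k}) \<and>
          tr_solution (f (x k)) (g (x k)) (H (x k)) (V k) (\<Delta> k) (a k) \<and>
          tr_multiplier (g (x k)) (H (x k)) (V k) (\<Delta> k) (a k) (l k) \<and>
          x (Suc k) = x k + cols_mult (V k) (a k))"

definition second_order_stationary ::
    "(real ^ 'n \<Rightarrow> real ^ 'n) \<Rightarrow> (real ^ 'n \<Rightarrow> real ^ 'n ^ 'n) \<Rightarrow> real ^ 'n \<Rightarrow> bool" where
  "second_order_stationary g H x \<longleftrightarrow> g x = 0 \<and> psd (H x)"

end

theory Submission
  imports Defs
begin

text \<open>
  Near \<open>x\<^sup>*\<close> the Hessian is bounded below by \<open>\<mu>/2\<close>, so testing the optimality system with the step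
  gives \<open>\<parallel>d\<parallel> \<le> 2\<parallel>g\<parallel>/\<mu> \<le> 2L\<parallel>x - x\<^sup>*\<parallel>/\<mu>\<close>. Close to \<open>x\<^sup>*\<close> the trust region is therefore inactive and the
  multiplier vanishes. Since \<open>g\<close> lies in the subspace, the projected Hessian then maps \<open>d\<close> exactly
  to \<open>-g\<close>, and the accuracy hypothesis turns \<open>d\<close> into an inexact Newton step with residual
  \<open>O(\<parallel>d\<parallel>\<^sup>2)\<close>, to which the usual local analysis of Newton's method applies.
\<close>

section \<open>Matrices with orthonormal columns\<close>

lemma inner_cols_mult: "cols_mult V a \<bullet> v = (\<Sum>i<length V. a i * (V ! i \<bullet> v))"
  by (simp add: cols_mult_def inner_sum_left)

lemma orthonormal_basis_inner_cols_mult: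
  assumes "orthonormal_basis V S" "i < length V"
  shows "V ! i \<bullet> cols_mult V a = a i"
proof -
  have "V ! i \<bullet> cols_mult V a = (\<Sum>j<length V. a j * (V ! i \<bullet> V ! j))"
    by (simp add: cols_mult_def inner_sum_right)
  also have "\<dots> = (\<Sum>j<length V. if i = j then a j else 0)"
    using assms by (intro sum.cong) (auto simp: orthonormal_basis_def)
  finally show ?thesis
    using assms(2) by simp
qed

lemma norm_cols_mult:
  assumes "orthonormal_basis V S"
  shows "norm (cols_mult V a) = L2_set a {..<length V}"
proof -
  have "cols_mult V a \<bullet> cols_mult V a = (\<Sum>i<length V. a i * a i)"
    using orthonormal_basis_inner_cols_mult[OF assms] by (simp add: inner_cols_mult)
  then show ?thesis
    by (simp add: norm_eq_sqrt_inner L2_set_def power2_eq_square)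
qed

lemma cols_gram_mult: "cols_gram V *v v = cols_mult V (cols_transpose_mult V v)"
proof -
  have "(cols_gram V *v v) $ a = cols_mult V (cols_transpose_mult V v) $ a" for a
  proof -
    have "(cols_gram V *v v) $ a = (\<Sum>b\<in>UNIV. \<Sum>i<length V. V ! i $ a * V ! i $ b * v $ b)"
      by (simp add: cols_gram_def matrix_vector_mult_def sum_distrib_right)
    also have "\<dots> = (\<Sum>i<length V. \<Sum>b\<in>UNIV. V ! i $ a * V ! i $ b * v $ b)"
      by (rule sum.swap)
    also have "\<dots> = cols_mult V (cols_transpose_mult V v) $ a"
      by (simp add: cols_mult_def cols_transpose_mult_def inner_vec_def sum_distrib_left
            sum_distrib_right mult_ac)
    finally show ?thesis .
  qed
  then show ?thesis
    by (simp add: vec_eq_iff)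
qed

lemma cols_gram_cols_mult:
  assumes "orthonormal_basis V S"
  shows "cols_gram V *v cols_mult V a = cols_mult V a"
  unfolding cols_gram_mult
  by (auto simp: cols_mult_def cols_transpose_mult_def
        orthonormal_basis_inner_cols_mult[OF assms, unfolded cols_mult_def] intro!: sum.cong)

text \<open>\<open>cols_gram V\<close> is the orthogonal projection onto \<open>S\<close>. The
  vectors it fixes form a subspace, so checking the columns is enough. The case of interest is the
  gradient, one of the generators of the DRSOM subspace.\<close>

lemma cols_gram_span:
  assumes "orthonormal_basis V S" "v \<in> S"
  shows "cols_gram V *v v = v"
proof -
  have "v \<in> span (set V)"
    using assms by (simp add: orthonormal_basis_def)
  then show ?thesis
  proof (induction rule: span_induct)
    show "subspace {v. cols_gram V *v v = v}"
      by (auto simp: subspace_def matrix_vector_right_distrib matrix_vector_mult_scaleR)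
  next
    fix w assume "w \<in> set V"
    then obtain j where j: "j < length V" "w = V ! j"
      by (auto simp: in_set_conv_nth)
    \<comment> \<open>A column is \<open>V\<close> applied to a unit coordinate vector, hence of the
      form already known to be fixed.\<close>
    have "w = (\<Sum>i<length V. if i = j then V ! i else 0)"
      using j by simp
    also have "\<dots> = cols_mult V (\<lambda>i. if i = j then 1 else 0)"
      unfolding cols_mult_def by (intro sum.cong) auto
    finally show "cols_gram V *v w = w"
      using cols_gram_cols_mult[OF assms(1)] by metis
  qed
qed

section \<open>The reduced optimality system, lifted to the full space\<close>

lemma mult_r_reduced_hessian:
  "mult_r (length V) (reduced_hessian H V) a i = V ! i \<bullet> (H *v cols_mult V a)"
  by (simp add: mult_r_def reduced_hessian_def cols_mult_def linear_sum[OF matrix_vector_mul_linear]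
        matrix_vector_mult_scaleR inner_sum_right mult_ac)

lemma mult_r_shift_r:
  assumes "i < r"
  shows "mult_r r (shift_r A c) a i = mult_r r A a i + c * a i"
proof -
  have "mult_r r (shift_r A c) a i
      = (\<Sum>j<r. A i j * a j) + (\<Sum>j<r. if i = j then c * a j else 0)"
    unfolding mult_r_def shift_r_def sum.distrib[symmetric]
    by (intro sum.cong) (auto simp: distrib_right)
  then show ?thesis
    using assms by (simp add: mult_r_def)
qed

lemma tr_multiplier_component:
  assumes "tr_multiplier g H V \<Delta> a l" "i < length V"
  shows "V ! i \<bullet> (H *v cols_mult V a) + l * a i = - (V ! i \<bullet> g)"
  using assms
  by (simp add: tr_multiplier_def mult_r_shift_r mult_r_reduced_hessian cols_transpose_mult_def)

text \<open>Multiply row \<open>i\<close> of the optimality system by \<open>a i\<close> and sum;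
  orthonormality turns the sum of the squares of \<open>a i\<close> into the squared norm of
  \<open>d\<close>.\<close>

lemma tr_multiplier_inner_step:
  assumes "orthonormal_basis V S" "tr_multiplier g H V \<Delta> a l"
  defines "d \<equiv> cols_mult V a"
  shows "d \<bullet> (H *v d) + l * (norm d)\<^sup>2 = - (d \<bullet> g)"
proof -
  have "(norm d)\<^sup>2 = (\<Sum>i<length V. a i * a i)"
    using orthonormal_basis_inner_cols_mult[OF assms(1)]
    by (simp add: power2_norm_eq_inner d_def inner_cols_mult)
  then have "d \<bullet> (H *v d) + l * (norm d)\<^sup>2
      = (\<Sum>i<length V. a i * (V ! i \<bullet> (H *v d) + l * a i))"
    by (simp add: d_def inner_cols_mult sum_distrib_left sum.distrib[symmetric] algebra_simps)
  also have "\<dots> = (\<Sum>i<length V. a i * - (V ! i \<bullet> g))"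
    using tr_multiplier_component[OF assms(2)] by (simp add: d_def)
  also have "\<dots> = - (d \<bullet> g)"
    by (simp add: d_def inner_cols_mult sum_negf)
  finally show ?thesis .
qed

text \<open>Cauchy-Schwarz, then cancel \<open>norm v\<close>. This replaces a bound on the inverse
  of \<open>A\<close>, which is never formed.\<close>

lemma matrix_lower_bound_norm:
  fixes A :: "real ^ 'n ^ 'n"
  assumes "c * (norm v)\<^sup>2 \<le> v \<bullet> (A *v v)"
  shows "c * norm v \<le> norm (A *v v)"
proof (cases "v = 0")
  case False
  have "norm v * (c * norm v) \<le> norm v * norm (A *v v)"
    using assms Cauchy_Schwarz_ineq2[of v "A *v v"]
    by (simp add: power2_eq_square algebra_simps)
  then show ?thesis
    using False by simp
qed simp

lemma tr_multiplier_step_le: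
  assumes "orthonormal_basis V S" "tr_multiplier g H V \<Delta> a l"
    and coercive: "\<And>v. c * (norm v)\<^sup>2 \<le> v \<bullet> (H *v v)"
  shows "c * norm (cols_mult V a) \<le> norm g"
proof (cases "cols_mult V a = 0")
  case False
  let ?d = "cols_mult V a"
  have "l \<ge> 0"
    using assms(2) by (simp add: tr_multiplier_def)
  then have "c * (norm ?d)\<^sup>2 \<le> - (?d \<bullet> g)"
    using coercive[of ?d] tr_multiplier_inner_step[OF assms(1,2)]
    by (smt (verit) mult_nonneg_nonneg zero_le_power2)
  also have "\<dots> \<le> norm ?d * norm g"
    using Cauchy_Schwarz_ineq2[of ?d g] by linarith
  finally have "norm ?d * (c * norm ?d) \<le> norm ?d * norm g"
    by (simp add: power2_eq_square mult_ac)
  then show ?thesis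
    using False by simp
qed simp

lemma tr_multiplier_projected_hessian_step:
  assumes "orthonormal_basis V S" "g \<in> S" "tr_multiplier g H V \<Delta> a l"
    and inactive: "norm (cols_mult V a) < \<Delta>"
  shows "projected_hessian H V *v cols_mult V a = - g"
proof -
  let ?d = "cols_mult V a"
  \<comment> \<open>Complementarity: the slack is positive because \<open>a\<close> and the step
    have the same norm.\<close>
  have "l = 0"
    using assms(3) inactive by (auto simp: tr_multiplier_def norm_cols_mult[OF assms(1)])
  have "projected_hessian H V *v ?d = cols_gram V *v (H *v ?d)"
    by (simp add: projected_hessian_def matrix_vector_mul_assoc[symmetric]
          cols_gram_cols_mult[OF assms(1)])
  also have "\<dots> = cols_mult V (cols_transpose_mult V (- g))"
    unfolding cols_gram_mult cols_mult_def
    using tr_multiplier_component[OF assms(3)] \<open>l = 0\<close>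
    by (intro sum.cong) (auto simp: cols_transpose_mult_def cols_mult_def)
  also have "\<dots> = cols_gram V *v (- g)"
    by (simp add: cols_gram_mult)
  also have "\<dots> = - g"
    using cols_gram_span[OF assms(1,2)] by (simp add: vec.neg)
  finally show ?thesis .
qed

lemma first_order_taylor_bound:
  fixes g :: "'a::euclidean_space \<Rightarrow> 'b::real_normed_vector"
  assumes deriv: "\<And>x. (g has_derivative g' x) (at x)"
    and lipschitz: "\<And>x y. onorm (\<lambda>v. g' x v - g' y v) \<le> M * norm (x - y)" and "M \<ge> 0"
  shows "norm (g y - g x - g' x (y - x)) \<le> M * (norm (y - x))\<^sup>2"
proof -
  let ?S = "cball x (norm (y - x))"
  interpret bounded_linear "g' x"
    using deriv by (rule has_derivative_bounded_linear)
  have "norm ((g y - g' x y) - (g x - g' x x)) \<le> (M * norm (y - x)) * norm (y - x)"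
  \<comment> \<open>The mean value inequality is applied to \<open>g\<close> minus its linear part
    at \<open>x\<close>, whose derivative at \<open>z\<close> is the difference of the derivatives
    of \<open>g\<close> at \<open>z\<close> and \<open>x\<close>. Integrating along the segment
    would give M/2, but the constant M suffices.\<close>
  proof (rule differentiable_bound[where S = ?S and f' = "\<lambda>z v. g' z v - g' x v"])
    fix z assume z: "z \<in> ?S"
    show "((\<lambda>z. g z - g' x z) has_derivative (\<lambda>v. g' z v - g' x v)) (at z within ?S)"
      by (intro has_derivative_diff has_derivative_at_withinI[OF deriv]
            bounded_linear_imp_has_derivative bounded_linear_axioms)
    have "onorm (\<lambda>v. g' z v - g' x v) \<le> M * norm (z - x)"
      by (rule lipschitz)
    also have "\<dots> \<le> M * norm (y - x)"
      using z \<open>M \<ge> 0\<close> by (intro mult_left_mono) (auto simp: dist_norm norm_minus_commute)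
    finally show "onorm (\<lambda>v. g' z v - g' x v) \<le> M * norm (y - x)" .
  qed (auto simp: dist_norm norm_minus_commute)
  moreover have "(g y - g' x y) - (g x - g' x x) = g y - g x - g' x (y - x)"
    by (simp add: diff)
  ultimately show ?thesis
    by (simp add: power2_eq_square mult_ac)
qed

text \<open>The quadratic form of \<open>B - A\<close> is at most r times the squared norm in
  absolute value. Here \<open>A\<close> will be the Hessian at the solution and \<open>B\<close> the
  one at a nearby iterate.\<close>

lemma coercive_perturbation:
  fixes A B :: "real ^ 'n ^ 'n"
  assumes "psd (A - \<mu> *\<^sub>R mat 1)" "onorm (\<lambda>v. (B - A) *v v) \<le> r"
  shows "(\<mu> - r) * (norm v)\<^sup>2 \<le> v \<bullet> (B *v v)"
proof -
  have "0 \<le> v \<bullet> ((A - \<mu> *\<^sub>R mat 1) *v v)"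
    using assms(1) by (simp add: psd_def)
  then have A: "\<mu> * (norm v)\<^sup>2 \<le> v \<bullet> (A *v v)"
    by (simp add: matrix_vector_mult_diff_rdistrib scaleR_matrix_vector_assoc[symmetric]
          inner_diff_right power2_norm_eq_inner)
  have "\<bar>v \<bullet> ((B - A) *v v)\<bar> \<le> norm v * norm ((B - A) *v v)"
    by (rule Cauchy_Schwarz_ineq2)
  also have "\<dots> \<le> norm v * (r * norm v)"
    using onorm[OF matrix_vector_mul_bounded_linear, of "B - A" v]
      mult_right_mono[OF assms(2) norm_ge_zero[of v]]
    by (intro mult_left_mono) auto
  finally have "- (r * (norm v)\<^sup>2) \<le> v \<bullet> ((B - A) *v v)"
    by (simp add: power2_eq_square mult_ac)
  also have "\<dots> = v \<bullet> (B *v v) - v \<bullet> (A *v v)"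
    by (simp add: matrix_vector_mult_diff_rdistrib inner_diff_right)
  finally show ?thesis
    using A by (simp add: left_diff_distrib)
qed

text \<open>Adding and subtracting \<open>g\<close> splits \<open>H *v (x + d - xs)\<close> into the
  residual of the Newton equation and, when the gradient vanishes at \<open>xs\<close>, the Taylor
  error there.\<close>

lemma inexact_newton_step:
  fixes H :: "real ^ 'n ^ 'n"
  assumes coercive: "\<And>v. c * (norm v)\<^sup>2 \<le> v \<bullet> (H *v v)"
    and residual: "norm (H *v d + g) \<le> R"
    and taylor: "norm (H *v (x - xs) - g) \<le> T"
  shows "c * norm (x + d - xs) \<le> R + T"
proof -
  have "c * norm (x + d - xs) \<le> norm (H *v (x + d - xs))"
    by (rule matrix_lower_bound_norm) (rule coercive)
  also have "H *v (x + d - xs) = (H *v d + g) + (H *v (x - xs) - g)"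
    by (simp add: matrix_vector_right_distrib matrix_vector_mult_diff_distrib)
  also have "norm \<dots> \<le> R + T"
    using norm_triangle_ineq residual taylor by (rule order_trans[OF _ add_mono])
  finally show ?thesis .
qed

text \<open>Inside the ball, K \<delta> \<le> 1/2 makes the quadratic step also a halving. The ball
  is therefore never left, and the decay is at least geometric.\<close>

lemma quadratic_recursion_tendsto:
  fixes x :: "nat \<Rightarrow> 'a::real_normed_vector"
  assumes step: "\<And>j. norm (x j - z) \<le> \<delta> \<Longrightarrow> norm (x (Suc j) - z) \<le> K * (norm (x j - z))\<^sup>2"
    and "K > 0" "K * \<delta> \<le> 1/2" "norm (x k - z) \<le> \<delta>"
  shows "x \<longlonglongrightarrow> z" and "j \<ge> k \<Longrightarrow> norm (x (Suc j) - z) \<le> K * (norm (x j - z))\<^sup>2"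
proof -
  have half: "norm (x (Suc j) - z) \<le> norm (x j - z) / 2" if "norm (x j - z) \<le> \<delta>" for j
  proof -
    have "norm (x (Suc j) - z) \<le> K * norm (x j - z) * norm (x j - z)"
      using step[OF that] by (simp add: power2_eq_square mult_ac)
    also have "\<dots> \<le> 1/2 * norm (x j - z)"
      using mult_left_mono[OF that, of K] assms(2,3)
      by (intro mult_right_mono norm_ge_zero) linarith
    finally show ?thesis
      by simp
  qed
  \<comment> \<open>Membership in the ball is carried through the induction because
    \<open>half\<close> is available only there.\<close>
  have decay: "norm (x (k + i) - z) \<le> \<delta> * (1/2) ^ i \<and> norm (x (k + i) - z) \<le> \<delta>" for i
  proof (induction i)
    case 0
    show ?case
      using assms(4) by simp
  next
    case (Suc i)
    then have "norm (x (k + Suc i) - z) \<le> norm (x (k + i) - z) / 2"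
      using half by simp
    moreover have "\<delta> * (1/2) ^ Suc i = \<delta> * (1/2) ^ i / 2"
      by simp
    ultimately show ?case
      using Suc norm_ge_zero[of "x (k + i) - z"] by linarith
  qed
  show "norm (x (Suc j) - z) \<le> K * (norm (x j - z))\<^sup>2" if "j \<ge> k"
    using step[of j] decay[of "j - k"] that by simp
  have "norm (x (i + k) - z) \<le> \<delta> * (1/2) ^ i" for i
    using decay[of i] by (simp add: add.commute[of i])
  moreover have "(\<lambda>i. \<delta> * (1/2) ^ i) \<longlonglongrightarrow> 0"
    by (intro tendsto_mult_right_zero LIMSEQ_realpow_zero) auto
  ultimately have "(\<lambda>i. x (i + k) - z) \<longlonglongrightarrow> 0"
    by (rule Lim_null_comparison[OF always_eventually[OF allI]])
  then have "(\<lambda>i. x (i + k)) \<longlonglongrightarrow> z"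
    by (simp add: LIM_zero_iff)
  then show "x \<longlonglongrightarrow> z"
    by (rule LIMSEQ_offset)
qed

theorem theorem3:
  fixes f :: "real ^ 'n \<Rightarrow> real"
    and g :: "real ^ 'n \<Rightarrow> real ^ 'n"
    and H :: "real ^ 'n \<Rightarrow> real ^ 'n ^ 'n"
    and xs :: "real ^ 'n"
    and L M \<epsilon> C \<mu> :: real
  assumes gradient: "\<And>x. GDERIV f x :> g x"
    and hessian: "\<And>x. (g has_derivative (\<lambda>h. H x *v h)) (at x)"
    and bounded_below: "bdd_below (range f)"
    and L_pos: "L > 0" and M_pos: "M > 0"
    and gradient_lipschitz: "\<And>x y. norm (g x - g y) \<le> L * norm (x - y)"
    and hessian_lipschitz: "\<And>x y. onorm (\<lambda>v. (H x - H y) *v v) \<le> M * norm (x - y)"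
    and eps_pos: "\<epsilon> > 0" and C_nonneg: "C \<ge> 0"
    and stationary: "second_order_stationary g H xs"
    and mu_pos: "\<mu> > 0"
    and hessian_lower: "psd (H xs - \<mu> *\<^sub>R mat 1)"
  shows "\<exists>\<delta>>0. \<exists>K>0. \<forall>x V a l.
           drsom f g H (\<lambda>_. 2 * sqrt \<epsilon> / M) x V a l \<longrightarrow>
           (\<forall>j. norm ((H (x j) - projected_hessian (H (x j)) (V j)) *v momentum x (Suc j))
                  \<le> C * (norm (momentum x (Suc j)))\<^sup>2) \<longrightarrow>
           (\<forall>k. norm (x k - xs) \<le> \<delta> \<longrightarrow>
                  x \<longlonglongrightarrow> xs \<and>
                  (\<forall>j\<ge>k. norm (x (Suc j) - xs) \<le> K * (norm (x j - xs))\<^sup>2))"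
proof -
  define \<Delta> where "\<Delta> = 2 * sqrt \<epsilon> / M"
  \<comment> \<open>\<open>c\<close> is the coercivity constant left near the solution. In
    \<open>K\<close>, C (L/c)^2 comes from the Newton residual, M from the Taylor error, and the
    division by c from inverting the Hessian.\<close>
  define c where "c = \<mu> / 2"
  define K where "K = (C * (L / c)\<^sup>2 + M) / c"
  \<comment> \<open>The three bounds in turn keep the Hessian coercive, make the trust region
    inactive, and turn the quadratic estimate into a halving. None depends on the run.\<close>
  define \<delta> where "\<delta> = min (\<mu> / (2 * M)) (min (c * \<Delta> / (2 * L)) (1 / (2 * K)))"
  have "c > 0"
    using mu_pos by (simp add: c_def)
  have "K > 0"
    using \<open>c > 0\<close> M_pos C_nonneg by (auto simp: K_def intro!: divide_pos_pos add_nonneg_pos)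
  have cK: "c * K = C * (L / c)\<^sup>2 + M"
    using \<open>c > 0\<close> by (simp add: K_def)
  have "\<Delta> > 0"
    using eps_pos M_pos by (simp add: \<Delta>_def)
  have "\<delta> > 0"
    using mu_pos M_pos L_pos \<open>\<Delta> > 0\<close> \<open>c > 0\<close> \<open>K > 0\<close> by (simp add: \<delta>_def)
  have \<delta>: "M * \<delta> \<le> \<mu> / 2" "L * \<delta> \<le> c * \<Delta> / 2" "K * \<delta> \<le> 1/2"
  proof -
    have "\<delta> \<le> \<mu> / (2 * M)" "\<delta> \<le> c * \<Delta> / (2 * L)" "\<delta> \<le> 1 / (2 * K)"
      by (simp_all add: \<delta>_def)
    from mult_left_mono[OF this(1), of M] mult_left_mono[OF this(2), of L]
      mult_left_mono[OF this(3), of K]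
    show "M * \<delta> \<le> \<mu> / 2" "L * \<delta> \<le> c * \<Delta> / 2" "K * \<delta> \<le> 1/2"
      using M_pos L_pos \<open>K > 0\<close> by simp_all
  qed
  have "g xs = 0"
    using stationary by (simp add: second_order_stationary_def)
  have step: "norm (x (Suc j) - xs) \<le> K * (norm (x j - xs))\<^sup>2"
    if run: "drsom f g H (\<lambda>_. \<Delta>) x V a l"
      and accuracy: "norm ((H (x j) - projected_hessian (H (x j)) (V j)) *v momentum x (Suc j))
                  \<le> C * (norm (momentum x (Suc j)))\<^sup>2"
      and near: "norm (x j - xs) \<le> \<delta>" for x V a l j
  proof -
    let ?d = "cols_mult (V j) (a j)" and ?e = "norm (x j - xs)"
    have basis: "orthonormal_basis (V j) (span {g (x j), momentum x j})"
      and mult: "tr_multiplier (g (x j)) (H (x j)) (V j) \<Delta> (a j) (l j)"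
      and next_x: "x (Suc j) = x j + ?d"
      using run by (auto simp: drsom_def)
    have "momentum x (Suc j) = ?d"
      by (simp add: momentum_def next_x)
    have "M * ?e \<le> \<mu> / 2"
      using mult_left_mono[OF near, of M] M_pos \<delta>(1) by linarith
    then have coercive: "c * (norm v)\<^sup>2 \<le> v \<bullet> (H (x j) *v v)" for v
      using coercive_perturbation[OF hessian_lower order_trans[OF hessian_lipschitz], of "x j" "\<mu> / 2" v]
      by (simp add: c_def)
    have "c * norm ?d \<le> norm (g (x j))"
      using basis mult coercive by (rule tr_multiplier_step_le)
    also have "\<dots> \<le> L * ?e"
      using gradient_lipschitz[of "x j" xs] \<open>g xs = 0\<close> by simp
    finally have step_le: "c * norm ?d \<le> L * ?e" .
    also have "L * ?e \<le> c * \<Delta> / 2"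
      using mult_left_mono[OF near, of L] L_pos \<delta>(2) by linarith
    \<comment> \<open>The spare factor 1/2 makes the inequality strict, as complementarity requires:
      a step of length exactly \<Delta> would leave the multiplier free.\<close>
    also have "\<dots> < c * \<Delta>"
      using \<open>c > 0\<close> \<open>\<Delta> > 0\<close> by simp
    finally have "norm ?d < \<Delta>"
      using \<open>c > 0\<close> by simp
    then have "projected_hessian (H (x j)) (V j) *v ?d = - g (x j)"
      by (intro tr_multiplier_projected_hessian_step[OF basis _ mult]) (auto intro: span_base)
    \<comment> \<open>As the projected Hessian sends the step to minus the gradient, the quantity
      bounded by \<open>accuracy\<close> is exactly the Newton residual.\<close>
    then have "norm (H (x j) *v ?d + g (x j)) \<le> C * (norm ?d)\<^sup>2"
      using accuracy \<open>momentum x (Suc j) = ?d\<close> by (simp add: matrix_vector_mult_diff_rdistrib)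
    also have "\<dots> \<le> C * (L / c * ?e)\<^sup>2"
      using step_le \<open>c > 0\<close> C_nonneg
      by (intro mult_left_mono power_mono) (auto simp: field_simps)
    finally have residual: "norm (H (x j) *v ?d + g (x j)) \<le> C * (L / c * ?e)\<^sup>2" .
    \<comment> \<open>The expansion is based at the iterate and evaluated at \<open>xs\<close>, so
      that the same matrix \<open>H (x j)\<close> appears as in the residual.\<close>
    have "norm (g xs - g (x j) - H (x j) *v (xs - x j)) \<le> M * (norm (xs - x j))\<^sup>2"
      using hessian_lipschitz M_pos
      by (intro first_order_taylor_bound[OF hessian])
        (auto simp: matrix_vector_mult_diff_rdistrib)
    moreover have "g xs - g (x j) - H (x j) *v (xs - x j) = H (x j) *v (x j - xs) - g (x j)"
      using \<open>g xs = 0\<close> by (simp add: matrix_vector_mult_diff_distrib)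
    ultimately have taylor: "norm (H (x j) *v (x j - xs) - g (x j)) \<le> M * ?e\<^sup>2"
      by (simp add: norm_minus_commute)
    have "c * norm (x (Suc j) - xs) \<le> C * (L / c * ?e)\<^sup>2 + M * ?e\<^sup>2"
      unfolding next_x using coercive residual taylor by (rule inexact_newton_step)
    also have "\<dots> = c * K * ?e\<^sup>2"
      unfolding cK power_mult_distrib by (simp only: distrib_right mult.assoc)
    finally show ?thesis
      using \<open>c > 0\<close> by (simp add: mult.assoc)
  qed
  show ?thesis
    unfolding \<Delta>_def[symmetric]
  proof (rule exI[of _ \<delta>], rule conjI[OF \<open>\<delta> > 0\<close>], rule exI[of _ K],
      rule conjI[OF \<open>K > 0\<close>], intro allI impI conjI)
    fix x V a l k
    assume "drsom f g H (\<lambda>_. \<Delta>) x V a l"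
      and "\<forall>j. norm ((H (x j) - projected_hessian (H (x j)) (V j)) *v momentum x (Suc j))
                  \<le> C * (norm (momentum x (Suc j)))\<^sup>2"
      and near: "norm (x k - xs) \<le> \<delta>"
    then have contraction: "norm (x (Suc j) - xs) \<le> K * (norm (x j - xs))\<^sup>2"
      if "norm (x j - xs) \<le> \<delta>" for j
      using step that by blast
    show "x \<longlonglongrightarrow> xs"
      by (rule quadratic_recursion_tendsto(1)[where x = x and z = xs, OF _ \<open>K > 0\<close> \<delta>(3) near])
        (rule contraction)
    show "norm (x (Suc j) - xs) \<le> K * (norm (x j - xs))\<^sup>2" if "j \<ge> k" for j
      by (rule quadratic_recursion_tendsto(2)[where x = x and z = xs, OF _ \<open>K > 0\<close> \<delta>(3) near that])
        (rule contraction)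
  qed
qed

end
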